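(* Let $n\ge 2$, $\mathbf{x}\in[0,1]^n$, $G\in\mathbb{R}^{n\times n}$, $\delta=\epsilon\,\mathbf{1}^\top\mathbf{x}>0$, and let $C\in\mathbb{R}^{n\times n}$ be a cost matrix with nonnegative entries and $C_{ij}=0\Leftrightarrow i=j$. Define $$g(\lambda)=\min_{\Pi\in\mathbb{R}^{n\times n},\ \Pi\mathbf{1}=\mathbf{x},\ \Pi\ge 0}\ \tfrac12\|\Pi-G\|_{\mathrm F}^2+\lambda\big(\langle\Pi,C\rangle-\delta\big).$$ Any solution $\lambda^\star$ of the dual problem $\max_{\lambda\ge0}g(\lambda)$ satisfies $$0\le\lambda^\star\le\frac{2\,\|\mathrm{vec}(G)\|_\infty+\|\mathbf{x}\|_\infty}{\min_{i\ne j}\{C_{ij}\}}.$$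
   Context: $\mathbf{1}\in\mathbb{R}^n$ is the all-ones vector; $\Pi\ge0$ is entrywise; $\langle A,B\rangle=\sum_{i,j}A_{ij}B_{ij}$; $\|\cdot\|_{\mathrm F}$ is the Frobenius norm; $\|\mathrm{vec}(G)\|_\infty=\max_{i,j}|G_{ij}|$ and $\|\mathbf{x}\|_\infty=\max_i|x_i|$. $\epsilon>0$ is a scalar. *)

theory Defs
  imports "HOL-Analysis.Analysis"
begin

definition feasible_plans :: "real^'n \<Rightarrow> (real^'n^'n) set" where
  "feasible_plans x = {P. P *v 1 = x \<and> (\<forall>i j. 0 \<le> P $ i $ j)}"

text \<open>On \<^typ>\<open>real^'n^'n\<close> the library's norm is the Frobenius norm and its inner product is the
  entrywise one; see \<open>frobenius_inner\<close> and \<open>frobenius_norm\<close> below.\<close>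

definition lagrangian ::
  "real^'n^'n \<Rightarrow> real^'n^'n \<Rightarrow> real \<Rightarrow> real \<Rightarrow> real^'n^'n \<Rightarrow> real" where
  "lagrangian G C \<delta> \<mu> P = 1/2 * (norm (P - G))\<^sup>2 + \<mu> * (P \<bullet> C - \<delta>)"

text \<open>The \<open>LEAST\<close> is a genuine minimum whenever \<open>x\<close> is nonnegative; see \<open>dual_fun_attained\<close>.\<close>

definition dual_fun ::
  "real^'n \<Rightarrow> real^'n^'n \<Rightarrow> real^'n^'n \<Rightarrow> real \<Rightarrow> real \<Rightarrow> real" where
  "dual_fun x G C \<delta> \<mu> = (LEAST v. v \<in> lagrangian G C \<delta> \<mu> ` feasible_plans x)"

lemma frobenius_inner: "A \<bullet> B = (\<Sum>i\<in>UNIV. \<Sum>j\<in>UNIV. A $ i $ j * B $ i $ j)"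
  for A B :: "real^'n^'n"
  by (simp add: inner_vec_def)

lemma frobenius_norm: "norm A = sqrt (\<Sum>i\<in>UNIV. \<Sum>j\<in>UNIV. (A $ i $ j)\<^sup>2)"
  for A :: "real^'n^'n"
  by (simp add: norm_eq_sqrt_inner frobenius_inner power2_eq_square)

lemma compact_feasible_plans: "compact (feasible_plans x)" for x :: "real^'n"
proof -
  have row: "(\<Sum>j\<in>UNIV. P $ i $ j) = x $ i" if "P \<in> feasible_plans x" for P i
    using that by (auto simp: feasible_plans_def matrix_vector_mult_def vec_eq_iff)
  have "norm P \<le> (\<Sum>i\<in>UNIV. x $ i)" if P: "P \<in> feasible_plans x" for P
  proof -
    have "norm P \<le> (\<Sum>i\<in>UNIV. norm (P $ i))"
      by (simp add: norm_vec_def L2_set_le_sum)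
    also have "\<dots> \<le> (\<Sum>i\<in>UNIV. \<Sum>j\<in>UNIV. \<bar>P $ i $ j\<bar>)"
      by (intro sum_mono norm_le_l1_cart)
    also have "\<dots> = (\<Sum>i\<in>UNIV. x $ i)"
      using P row[OF P] by (simp add: feasible_plans_def)
    finally show ?thesis .
  qed
  then have "bounded (feasible_plans x)"
    by (auto simp: bounded_iff)
  moreover have "closed (feasible_plans x)"
    unfolding feasible_plans_def matrix_vector_mult_def vec_eq_iff
    by (intro closed_Collect_conj closed_Collect_all closed_Collect_eq closed_Collect_le)
       (auto intro!: continuous_intros)
  ultimately show ?thesis
    by (simp add: compact_eq_bounded_closed)
qed

lemma dual_fun_attained:
  assumes "\<And>i. 0 \<le> x $ i"
  obtains P where "P \<in> feasible_plans x" and "dual_fun x G C \<delta> \<mu> = lagrangian G C \<delta> \<mu> P"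
    and "\<And>Q. Q \<in> feasible_plans x \<Longrightarrow> dual_fun x G C \<delta> \<mu> \<le> lagrangian G C \<delta> \<mu> Q"
proof -
  have "(\<chi> i j. if i = j then x $ i else 0) \<in> feasible_plans x"
    using assms by (simp add: feasible_plans_def matrix_vector_mult_def vec_eq_iff)
  then have ne: "feasible_plans x \<noteq> {}"
    by blast
  have "continuous_on (feasible_plans x) (lagrangian G C \<delta> \<mu>)"
    unfolding lagrangian_def by (intro continuous_intros)
  from continuous_attains_inf[OF compact_feasible_plans ne this]
  obtain P where P: "P \<in> feasible_plans x"
    and le: "\<And>Q. Q \<in> feasible_plans x \<Longrightarrow> lagrangian G C \<delta> \<mu> P \<le> lagrangian G C \<delta> \<mu> Q"
    by blast
  have "dual_fun x G C \<delta> \<mu> = lagrangian G C \<delta> \<mu> P"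
    unfolding dual_fun_def by (rule Least_equality) (use P le in auto)
  with P le show thesis
    by (intro that[of P]) auto
qed

end

theory Submission imports Defs begin

text \<open>Once \<open>\<lambda> C\<^sub>i\<^sub>j \<ge> x\<^sub>i + G\<^sub>i\<^sub>j - G\<^sub>i\<^sub>i\<close> for all \<open>i \<noteq> j\<close>, shifting mass from the diagonal to another
  entry of the same row cannot pay off, so by convexity the plan \<open>diag x\<close> minimises the Lagrangian.
  This plan has transport cost \<open>0\<close>, and the inequality holds when \<open>\<lambda>\<close> is the asserted bound \<open>b\<close>.
  Hence \<open>g b = 1/2 \<parallel>diag x - G\<parallel>\<^sup>2 - b \<delta>\<close>, whereas always \<open>g \<lambda> \<le> 1/2 \<parallel>diag x - G\<parallel>\<^sup>2 - \<lambda> \<delta>\<close>.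
  As \<open>\<delta> > 0\<close>, no \<open>\<lambda> > b\<close> maximises \<open>g\<close>.\<close>

definition diag_plan :: "real^'n \<Rightarrow> real^'n^'n" where
  "diag_plan x = (\<chi> i j. if i = j then x $ i else 0)"

lemma diag_plan_feasible:
  assumes "\<And>i. 0 \<le> x $ i"
  shows "diag_plan x \<in> feasible_plans x"
  using assms by (simp add: diag_plan_def feasible_plans_def matrix_vector_mult_def vec_eq_iff)

lemma sum_row_feasible_plans:
  assumes "P \<in> feasible_plans x"
  shows "(\<Sum>j\<in>UNIV. P $ i $ j) = x $ i"
  using assms by (auto simp: feasible_plans_def matrix_vector_mult_def vec_eq_iff)

lemma lagrangian_diag_plan:
  assumes "\<And>i. C $ i $ i = 0"
  shows "lagrangian G C \<delta> \<mu> (diag_plan x) = 1/2 * (norm (diag_plan x - G))\<^sup>2 - \<mu> * \<delta>"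
proof -
  have "diag_plan x \<bullet> C = 0"
    unfolding frobenius_inner diag_plan_def
    by (intro sum.neutral ballI) (use assms in auto)
  then show ?thesis
    by (simp add: lagrangian_def)
qed

text \<open>The Lagrangian is quadratic in the plan, with gradient
  \<open>D - G + \<mu> *\<^sub>R C\<close> at \<open>D\<close>; the exact remainder
  \<open>1/2 * (norm (P - D))\<^sup>2\<close> is dropped.\<close>

lemma lagrangian_ge_linearization:
  "lagrangian G C \<delta> \<mu> P \<ge> lagrangian G C \<delta> \<mu> D + (D - G + \<mu> *\<^sub>R C) \<bullet> (P - D)"
proof -
  have "(norm (P - G))\<^sup>2 = (norm (D - G))\<^sup>2 + 2 * ((D - G) \<bullet> (P - D)) + (norm (P - D))\<^sup>2"
    by (simp add: power2_norm_eq_inner algebra_simps inner_commute)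
  then have "(norm (D - G))\<^sup>2 + 2 * ((D - G) \<bullet> (P - D)) \<le> (norm (P - G))\<^sup>2"
    by simp
  then show ?thesis
    by (simp add: lagrangian_def algebra_simps inner_commute)
qed

text \<open>By the linearization it suffices that the gradient at \<open>diag_plan x\<close> pairs
  nonnegatively with \<open>P - diag_plan x\<close>; this holds row by row.\<close>

lemma lagrangian_diag_plan_le:
  fixes x :: "real^'n" and G C P :: "real^'n^'n"
  assumes P: "P \<in> feasible_plans x"
    and C: "\<And>i. C $ i $ i = 0"
    and \<mu>: "\<And>i j. i \<noteq> j \<Longrightarrow> x $ i + G $ i $ j - G $ i $ i \<le> \<mu> * C $ i $ j"
  shows "lagrangian G C \<delta> \<mu> (diag_plan x) \<le> lagrangian G C \<delta> \<mu> P"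
proof -
  let ?D = "diag_plan x"
  let ?W = "?D - G + \<mu> *\<^sub>R C"
  have P_nonneg: "0 \<le> P $ i $ j" for i j
    using P by (simp add: feasible_plans_def)
  have "0 \<le> (\<Sum>j\<in>UNIV. ?W $ i $ j * (P - ?D) $ i $ j)" for i
  proof -
    have row: "(\<Sum>j\<in>UNIV. (P - ?D) $ i $ j) = 0"
      using sum_row_feasible_plans[OF P, of i] by (simp add: diag_plan_def sum_subtractf)
    \<comment> \<open>Both plans have row sum \<open>x $ i\<close>, so a constant weight along the
      row contributes nothing; the diagonal gradient entry is the one to compare with.\<close>
    have "0 = ?W $ i $ i * (\<Sum>j\<in>UNIV. (P - ?D) $ i $ j)"
      unfolding row by simp
    also have "\<dots> = (\<Sum>j\<in>UNIV. ?W $ i $ i * (P - ?D) $ i $ j)"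
      by (rule sum_distrib_left)
    also have "\<dots> \<le> (\<Sum>j\<in>UNIV. ?W $ i $ j * (P - ?D) $ i $ j)"
    proof (intro sum_mono)
      fix j
      show "?W $ i $ i * (P - ?D) $ i $ j \<le> ?W $ i $ j * (P - ?D) $ i $ j"
      proof (cases "i = j")
        case False
        \<comment> \<open>Off the diagonal \<open>?D\<close> vanishes: the entries compared are
          \<open>x $ i - G $ i $ i\<close> and \<open>\<mu> * C $ i $ j - G $ i $ j\<close>, and the
          difference of plans is \<open>P $ i $ j\<close>.\<close>
        then have "?W $ i $ i \<le> ?W $ i $ j" and "0 \<le> (P - ?D) $ i $ j"
          using \<mu>[OF False] C P_nonneg by (simp_all add: diag_plan_def)
        then show ?thesis
          by (rule mult_right_mono)
      qed simp
    qed
    finally show ?thesis .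
  qed
  then have "0 \<le> ?W \<bullet> (P - ?D)"
    unfolding frobenius_inner by (rule sum_nonneg)
  then show ?thesis
    using lagrangian_ge_linearization[of G C \<delta> \<mu> ?D P] by linarith
qed

theorem proposition2:
  fixes x :: "real^'n" and G C :: "real^'n^'n" and \<epsilon> \<delta> \<mu> :: real
  assumes "CARD('n) \<ge> 2"
    and "\<forall>i. 0 \<le> x $ i \<and> x $ i \<le> 1"
    and "\<epsilon> > 0"
    and "\<delta> = \<epsilon> * (1 \<bullet> x)"
    and "\<delta> > 0"
    and "\<forall>i j. 0 \<le> C $ i $ j"
    and "\<forall>i j. C $ i $ j = 0 \<longleftrightarrow> i = j"
    and "is_arg_max (dual_fun x G C \<delta>) (\<lambda>l. 0 \<le> l) \<mu>"
  shows "0 \<le> \<mu> \<and>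
    \<mu> \<le> (2 * Max {\<bar>G $ i $ j\<bar> | i j. True} + Max {\<bar>x $ i\<bar> | i. True})
            / Min {C $ i $ j | i j. i \<noteq> j}"
proof -
  let ?g = "Max {\<bar>G $ i $ j\<bar> | i j. True}" and ?m = "Max {\<bar>x $ i\<bar> | i. True}"
  let ?c = "Min {C $ i $ j | i j. i \<noteq> j}" and ?D = "diag_plan x"
  let ?b = "(2 * ?g + ?m) / ?c"
  have x_nonneg: "0 \<le> x $ i" for i
    using assms(2) by blast
  have C_diag: "C $ i $ i = 0" for i
    using assms(7) by blast
  have G_le: "\<bar>G $ i $ j\<bar> \<le> ?g" for i j
  proof (rule Max_ge)
    have "{\<bar>G $ i $ j\<bar> | i j. True} = (\<lambda>(i, j). \<bar>G $ i $ j\<bar>) ` UNIV"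
      by auto
    then show "finite {\<bar>G $ i $ j\<bar> | i j. True}"
      by simp
  qed blast
  have x_le: "\<bar>x $ i\<bar> \<le> ?m" for i
    by (rule Max_ge) (auto simp: full_SetCompr_eq)
  have finite_C: "finite {C $ i $ j | i j. i \<noteq> j}"
    by (rule finite_subset[of _ "(\<lambda>(i, j). C $ i $ j) ` UNIV"]) auto
  have c_le: "?c \<le> C $ i $ j" if "i \<noteq> j" for i j
    by (rule Min_le[OF finite_C]) (use that in blast)
  \<comment> \<open>Two distinct indices make the set of off-diagonal costs nonempty, so
    \<open>?c\<close> is one of these costs and hence positive.\<close>
  have "\<exists>i j :: 'n. i \<noteq> j"
    using assms(1) ex_card[of 2 "UNIV :: 'n set"] by (auto simp: card_2_iff)
  then have "?c \<in> {C $ i $ j | i j. i \<noteq> j}"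
    by (intro Min_in[OF finite_C]) blast
  then have c_pos: "0 < ?c"
    using assms(6,7) by (auto simp: less_le)
  have b_nonneg: "0 \<le> ?b"
    \<comment> \<open>Any index will do here: \<open>undefined\<close> just yields
      \<open>0 \<le> ?g\<close> and \<open>0 \<le> ?m\<close>.\<close>
    using G_le[of undefined undefined] x_le[of undefined] c_pos by simp
  have b_large: "x $ i + G $ i $ j - G $ i $ i \<le> ?b * C $ i $ j" if "i \<noteq> j" for i j
  proof -
    have "x $ i + G $ i $ j - G $ i $ i \<le> 2 * ?g + ?m"
      using G_le[of i j] G_le[of i i] x_le[of i] by linarith
    also have "\<dots> = ?b * ?c"
      using c_pos by simp
    also have "\<dots> \<le> ?b * C $ i $ j"
      using c_le[OF that] b_nonneg by (rule mult_left_mono)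
    finally show ?thesis .
  qed
  obtain P where P: "P \<in> feasible_plans x" "dual_fun x G C \<delta> ?b = lagrangian G C \<delta> ?b P"
    by (rule dual_fun_attained[OF x_nonneg])
  have "1/2 * (norm (?D - G))\<^sup>2 - ?b * \<delta> \<le> dual_fun x G C \<delta> ?b"
    unfolding P(2) lagrangian_diag_plan[of C, OF C_diag, symmetric]
    using P(1) C_diag b_large by (rule lagrangian_diag_plan_le)
  \<comment> \<open>Being nonnegative, \<open>?b\<close> is a competitor in the dual
    problem.\<close>
  also have "\<dots> \<le> dual_fun x G C \<delta> \<mu>"
    using assms(8) b_nonneg by (simp only: is_arg_max_def not_ex de_Morgan_conj not_less) blast
  also have "\<dots> \<le> lagrangian G C \<delta> \<mu> ?D"
    by (rule dual_fun_attained[OF x_nonneg]) (use diag_plan_feasible[OF x_nonneg] in blast)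
  also have "\<dots> = 1/2 * (norm (?D - G))\<^sup>2 - \<mu> * \<delta>"
    using C_diag by (rule lagrangian_diag_plan)
  finally have "\<mu> * \<delta> \<le> ?b * \<delta>"
    by linarith
  then have "\<mu> \<le> ?b"
    using assms(5) by (rule mult_right_le_imp_le)
  then show ?thesis
    using assms(8) by (simp add: is_arg_max_def)
qed

end
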